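(* Let $(A,\ast,\alpha)$ be a Hom-alternative algebra and $\mathcal{R}:A\to A$ a Rota-Baxter operator of weight $0$ on it with $\mathcal{R}\alpha=\alpha\mathcal{R}$. Let $(A,\prec,\succ,\alpha)$ be the Hom-pre-alternative algebra with $x\prec y=x\ast\mathcal{R}(y)$, $x\succ y=\mathcal{R}(x)\ast y$, and let $(A,\cdot,\alpha)$ be the multiplicative Hom-pre-Malcev algebra with $x\cdot y=x\succ y-y\prec x$. Let $(V,L_\prec,R_\prec,L_\succ,R_\succ,\beta)$ be a representation of $(A,\prec,\succ,\alpha)$ and $T:V\to A$ an $\mathcal{O}$-operator of $(A,\prec,\succ,\alpha)$ associated to it. Then $(V,L_\succ-R_\prec,R_\succ-L_\prec,\beta)$ is a representation of the Hom-pre-Malcev algebra $(A,\cdot,\alpha)$, and $T$ is an $\mathcal{O}$-operator of $(A,\cdot,\alpha)$ with respect to $(V,L_\succ-R_\prec,R_\succ-L_\prec,\beta)$. Moreover, if $(V,\blacktriangleright,\blacktriangleleft,\beta)$ is the Hom-M-dendriform algebra associated to $(A,\cdot,\alpha)$, $T$ and the representation $(V,\ell,r,\beta)=(V,L_\succ-R_\prec,R_\succ-L_\prec,\beta)$, that is $a\blacktriangleright b=r(T(b))a$ and $a\blacktriangleleft b=\ell(T(a))b$, then for all $a,b\in V$ $$a\blacktriangleright b=a\nearrow b-b\swarrow a,\qquad a\blacktriangleleft b=a\searrow b-b\nwarrow a,$$ where $a\searrow b=L_\succ(T(a))b$, $a\nearrow b=R_\succ(T(b))a$, $a\swarrow b=L_\prec(T(a))b$,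 $a\nwarrow b=R_\prec(T(b))a$.
   Context: All vector spaces are over a field $\mathbb{K}$ of characteristic $0$. A Hom-alternative algebra $(A,\ast,\alpha)$ is a vector space with a bilinear product $\ast$ and a linear map $\alpha$ with $\alpha(x\ast y)=\alpha(x)\ast\alpha(y)$ such that $as_\alpha(x,y,z)=(x\ast y)\ast\alpha(z)-\alpha(x)\ast(y\ast z)$ satisfies $as_\alpha(x,y,z)+as_\alpha(y,x,z)=0$ and $as_\alpha(x,y,z)+as_\alpha(x,z,y)=0$. A Rota-Baxter operator of weight $0$ on it is a linear map $\mathcal{R}:A\to A$ with $\mathcal{R}\alpha=\alpha\mathcal{R}$ and $\mathcal{R}(x)\ast\mathcal{R}(y)=\mathcal{R}(\mathcal{R}(x)\ast y+x\ast\mathcal{R}(y))$. A Hom-pre-alternative algebra $(A,\prec,\succ,\alpha)$ is a vector space with bilinear products $\prec,\succ$ and a linear map $\alpha$ which is a morphism for both products such that, with $x\ast y=x\prec y+x\succ y$, for all $x,y,z\in A$: $$(x\succ y)\prec\alpha(z)-\alpha(x)\succ(y\prec z)+(y\prec x)\prec\alpha(z)-\alpha(y)\prec(x\ast z)=0,$$ $$(x\succ y)\prec\alpha(z)-\alpha(x)\succ(y\prec z)+(x\ast z)\succ\alpha(y)-\alpha(x)\succ(z\succ y)=0,$$ $$(x\ast y+y\ast x)\succ\alpha(z)-\alpha(x)\succ(y\succ z)-\alpha(y)\succ(x\succ z)=0,$$ $$(x\prec y)\prec\alpha(z)+(x\prec z)\prec\alpha(y)-\alpha(x)\prec(y\ast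 z+z\ast y)=0.$$ (Here $\ast$ denotes the sum product of the pre-alternative algebra, not the original product of $A$.) A representation $(V,L_\prec,R_\prec,L_\succ,R_\succ,\beta)$ of $(A,\prec,\succ,\alpha)$ consists of a vector space $V$, $\beta\in \mathrm{End}(V)$ and linear maps $L_\prec,R_\prec,L_\succ,R_\succ:A\to \mathrm{End}(V)$ such that $(A\oplus V,\ll,\gg,\alpha+\beta)$ is a Hom-pre-alternative algebra, where $(x+a)\ll(y+b)=x\prec y+L_\prec(x)b+R_\prec(y)a$, $(x+a)\gg(y+b)=x\succ y+L_\succ(x)b+R_\succ(y)a$ and $(\alpha+\beta)(x+a)=\alpha(x)+\beta(a)$ for $x,y\in A$, $a,b\in V$. An $\mathcal{O}$-operator of $(A,\prec,\succ,\alpha)$ associated to it is a linear map $T:V\to A$ with $T\beta=\alpha T$, $T(a)\succ T(b)=T(L_\succ(T(a))b+R_\succ(T(b))a)$, $T(a)\prec T(b)=T(L_\prec(T(a))b+R_\prec(T(b))a)$ for all $a,b\in V$. A Hom-pre-Malcev algebra is a triple $(A,\cdot,\alpha)$ consisting of a vector space $A$, a bilinear product $\cdot:A\times A\to A$ and a linear map $\alpha:A\to A$ such that for all $x,y,z,t\in A$, with $[x,y]=x\cdot y-y\cdot x$, $$\alpha([y,z])\cdot\alpha(x\cdot t)+[[x,y],\alpha(z)]\cdot\alpha^2(t)+\alpha^2(y)\cdot([x,z]\cdot\alpha(t))-\alpha^2(x)\cdot(\alpha(y)\cdot(z\cdot t))+\alpha^2(z)\cdot(\alpha(x)\cdot(y\cdot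 t))=0.$$ It is multiplicative if $\alpha(x\cdot y)=\alpha(x)\cdot\alpha(y)$. A representation of $(A,\cdot,\alpha)$ is a quadruple $(V,\ell,r,\beta)$, where $V$ is a vector space, $\beta\in \mathrm{End}(V)$ and $\ell,r:A\to \mathrm{End}(V)$ are linear maps such that, with $\rho=\ell-r$, for all $x,y,z\in A$: $$\ell(\alpha(x))\beta=\beta\ell(x),\qquad r(\alpha(x))\beta=\beta r(x),$$ $$\ell([[x,y],\alpha(z)])\beta^2=\ell(\alpha^2(x))\ell(\alpha(y))\ell(z)-\ell(\alpha^2(z))\ell(\alpha(x))\ell(y)+\ell(\alpha^2(y))\ell([z,x])\beta-\ell(\alpha([y,z]))\ell(\alpha(x))\beta,$$ $$r(\alpha^2(x))\rho(\alpha(y))\rho(z)-r(\alpha(z)\cdot(y\cdot x))\beta^2+\ell(\alpha^2(y))r(z\cdot x)\beta+\ell(\alpha([z,y]))r(\alpha(x))\beta-\ell(\alpha^2(z))r(\alpha(x))\rho(y)=0,$$ $$\ell(\alpha^2(y))\ell(\alpha(z))r(x)-r(\alpha^2(x))\rho(\alpha(y))\rho(z)-\ell(\alpha^2(z))r(y\cdot x)\beta-r(\alpha(z\cdot x))\rho(\alpha(y))\beta+r([z,y]\cdot\alpha(x))\beta^2=0,$$ $$r(\alpha(y)\cdot(z\cdot x))\beta^2+r(\alpha^2(x))\rho([y,z])\beta-\ell(\alpha^2(y))\ell(\alpha(z))r(x)+r(\alpha(y\cdot x))\rho(\alpha(z))\beta+\ell(\alpha^2(z))r(\alpha(x))\rho(y)=0.$$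 An $\mathcal{O}$-operator of $(A,\cdot,\alpha)$ with respect to $(V,\ell,r,\beta)$ is a linear map $T:V\to A$ with $T\beta=\alpha T$ and $T(a)\cdot T(b)=T(\ell(T(a))b+r(T(b))a)$ for all $a,b\in V$; in that case $a\blacktriangleright b=r(T(b))a$, $a\blacktriangleleft b=\ell(T(a))b$ make $(V,\blacktriangleright,\blacktriangleleft,\beta)$ into a Hom-M-dendriform algebra. *)

theory Defs
  imports "HOL-Analysis.Product_Vector"
begin

text \<open>A vector space over a field of characteristic \<open>0\<close> is a type of class
  \<open>ab_group_add\<close> together with a scalar multiplication satisfying the locale \<open>vector_space\<close>.
  A linear map from \<open>A\<close> to \<open>End(V)\<close> is represented by the function
  \<open>A \<Rightarrow> V \<Rightarrow> V\<close>, linear in each of the two arguments; hence one notion of bilinear map serves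
  both for products and for the structure maps of representations.\<close>

definition bilinear_map ::
    "('k::field \<Rightarrow> 'a::ab_group_add \<Rightarrow> 'a) \<Rightarrow> ('k \<Rightarrow> 'b::ab_group_add \<Rightarrow> 'b) \<Rightarrow>
     ('k \<Rightarrow> 'c::ab_group_add \<Rightarrow> 'c) \<Rightarrow> ('a \<Rightarrow> 'b \<Rightarrow> 'c) \<Rightarrow> bool"
  where "bilinear_map s1 s2 s3 f \<longleftrightarrow>
    (\<forall>x. Vector_Spaces.linear s2 s3 (\<lambda>y. f x y)) \<and> (\<forall>y. Vector_Spaces.linear s1 s3 (\<lambda>x. f x y))"


subsection \<open>Hom-alternative algebras\<close>

definition hom_associator :: "('a \<Rightarrow> 'a \<Rightarrow> 'a) \<Rightarrow> ('a \<Rightarrow> 'a) \<Rightarrow> 'a \<Rightarrow> 'a \<Rightarrow> 'a \<Rightarrow> 'a::ab_group_add"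
  where "hom_associator mul \<alpha> x y z = mul (mul x y) (\<alpha> z) - mul (\<alpha> x) (mul y z)"

locale hom_alternative_algebra = vector_space scale
  for scale :: "'k::field_char_0 \<Rightarrow> 'a::ab_group_add \<Rightarrow> 'a" +
  fixes mul :: "'a \<Rightarrow> 'a \<Rightarrow> 'a" and \<alpha> :: "'a \<Rightarrow> 'a"
  assumes bilinear_mul: "bilinear_map scale scale scale mul"
    and linear_alpha: "Vector_Spaces.linear scale scale \<alpha>"
    and alpha_mul: "\<alpha> (mul x y) = mul (\<alpha> x) (\<alpha> y)"
    and left_alternative: "hom_associator mul \<alpha> x y z + hom_associator mul \<alpha> y x z = 0"
    and right_alternative: "hom_associator mul \<alpha> x y z + hom_associator mul \<alpha> x z y = 0"

locale rota_baxter_operator = hom_alternative_algebra scale mul \<alpha>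
  for scale :: "'k::field_char_0 \<Rightarrow> 'a::ab_group_add \<Rightarrow> 'a"
    and mul :: "'a \<Rightarrow> 'a \<Rightarrow> 'a" and \<alpha> :: "'a \<Rightarrow> 'a" +
  fixes R :: "'a \<Rightarrow> 'a"
  assumes linear_R: "Vector_Spaces.linear scale scale R"
    and R_alpha: "R (\<alpha> x) = \<alpha> (R x)"
    and rota_baxter: "mul (R x) (R y) = R (mul (R x) y + mul x (R y))"


subsection \<open>Hom-pre-alternative algebras\<close>

locale two_products =
  fixes prec :: "'a \<Rightarrow> 'a \<Rightarrow> 'a::ab_group_add" (infixl \<open>\<prec>\<close> 70)
    and succ :: "'a \<Rightarrow> 'a \<Rightarrow> 'a" (infixl \<open>\<succ>\<close> 70)
begin

abbreviation sum_product :: "'a \<Rightarrow> 'a \<Rightarrow> 'a" (infixl \<open>\<star>\<close> 70)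
  where "x \<star> y \<equiv> x \<prec> y + x \<succ> y"

end

locale hom_pre_alternative_algebra = vector_space scale + two_products prec succ
  for scale :: "'k::field_char_0 \<Rightarrow> 'a::ab_group_add \<Rightarrow> 'a"
    and prec :: "'a \<Rightarrow> 'a \<Rightarrow> 'a" (infixl \<open>\<prec>\<close> 70)
    and succ :: "'a \<Rightarrow> 'a \<Rightarrow> 'a" (infixl \<open>\<succ>\<close> 70) +
  fixes \<alpha> :: "'a \<Rightarrow> 'a"
  assumes bilinear_prec: "bilinear_map scale scale scale (\<prec>)"
    and bilinear_succ: "bilinear_map scale scale scale (\<succ>)"
    and linear_alpha: "Vector_Spaces.linear scale scale \<alpha>"
    and alpha_prec: "\<alpha> (x \<prec> y) = \<alpha> x \<prec> \<alpha> y"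
    and alpha_succ: "\<alpha> (x \<succ> y) = \<alpha> x \<succ> \<alpha> y"
    and pre_alternative_1:
      "(x \<succ> y) \<prec> \<alpha> z - \<alpha> x \<succ> (y \<prec> z) + (y \<prec> x) \<prec> \<alpha> z - \<alpha> y \<prec> (x \<star> z) = 0"
    and pre_alternative_2:
      "(x \<succ> y) \<prec> \<alpha> z - \<alpha> x \<succ> (y \<prec> z) + (x \<star> z) \<succ> \<alpha> y - \<alpha> x \<succ> (z \<succ> y) = 0"
    and pre_alternative_3:
      "(x \<star> y + y \<star> x) \<succ> \<alpha> z - \<alpha> x \<succ> (y \<succ> z) - \<alpha> y \<succ> (x \<succ> z) = 0"
    and pre_alternative_4:
      "(x \<prec> y) \<prec> \<alpha> z + (x \<prec> z) \<prec> \<alpha> y - \<alpha> x \<prec> (y \<star> z + z \<star> y) = 0"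

definition semidirect_product ::
    "('a \<Rightarrow> 'a \<Rightarrow> 'a) \<Rightarrow> ('a \<Rightarrow> 'v \<Rightarrow> 'v) \<Rightarrow> ('a \<Rightarrow> 'v \<Rightarrow> 'v) \<Rightarrow> 'a \<times> 'v \<Rightarrow> 'a \<times> 'v \<Rightarrow> 'a \<times> 'v::ab_group_add"
  where "semidirect_product mul L R = (\<lambda>(x, a) (y, b). (mul x y, L x b + R y a))"

text \<open>The direct sum of \<open>A\<close> and \<open>V\<close> is the product type with the componentwise scalar
  multiplication \<open>module_prod.scale\<close>.\<close>

locale hom_pre_alternative_representation =
  A: hom_pre_alternative_algebra scaleA prec succ \<alpha> + V: vector_space scaleV
  for scaleA :: "'k::field_char_0 \<Rightarrow> 'a::ab_group_add \<Rightarrow> 'a"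
    and prec :: "'a \<Rightarrow> 'a \<Rightarrow> 'a" and succ :: "'a \<Rightarrow> 'a \<Rightarrow> 'a" and \<alpha> :: "'a \<Rightarrow> 'a"
    and scaleV :: "'k \<Rightarrow> 'v::ab_group_add \<Rightarrow> 'v" +
  fixes Lprec Rprec Lsucc Rsucc :: "'a \<Rightarrow> 'v \<Rightarrow> 'v" and \<beta> :: "'v \<Rightarrow> 'v"
  assumes linear_beta: "Vector_Spaces.linear scaleV scaleV \<beta>"
    and bilinear_Lprec: "bilinear_map scaleA scaleV scaleV Lprec"
    and bilinear_Rprec: "bilinear_map scaleA scaleV scaleV Rprec"
    and bilinear_Lsucc: "bilinear_map scaleA scaleV scaleV Lsucc"
    and bilinear_Rsucc: "bilinear_map scaleA scaleV scaleV Rsucc"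
    and semidirect: "hom_pre_alternative_algebra (module_prod.scale scaleA scaleV)
      (semidirect_product prec Lprec Rprec) (semidirect_product succ Lsucc Rsucc) (map_prod \<alpha> \<beta>)"

locale hom_pre_alternative_O_operator =
  hom_pre_alternative_representation scaleA prec succ \<alpha> scaleV Lprec Rprec Lsucc Rsucc \<beta>
  for scaleA :: "'k::field_char_0 \<Rightarrow> 'a::ab_group_add \<Rightarrow> 'a"
    and prec :: "'a \<Rightarrow> 'a \<Rightarrow> 'a" and succ :: "'a \<Rightarrow> 'a \<Rightarrow> 'a" and \<alpha> :: "'a \<Rightarrow> 'a"
    and scaleV :: "'k \<Rightarrow> 'v::ab_group_add \<Rightarrow> 'v"
    and Lprec Rprec Lsucc Rsucc :: "'a \<Rightarrow> 'v \<Rightarrow> 'v" and \<beta> :: "'v \<Rightarrow> 'v" +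
  fixes T :: "'v \<Rightarrow> 'a"
  assumes linear_T: "Vector_Spaces.linear scaleV scaleA T"
    and T_beta: "T (\<beta> a) = \<alpha> (T a)"
    and T_succ: "succ (T a) (T b) = T (Lsucc (T a) b + Rsucc (T b) a)"
    and T_prec: "prec (T a) (T b) = T (Lprec (T a) b + Rprec (T b) a)"


subsection \<open>Hom-pre-Malcev algebras\<close>

locale product_commutator =
  fixes dot :: "'a \<Rightarrow> 'a \<Rightarrow> 'a::ab_group_add" (infixl \<open>\<cdot>\<close> 70)
begin

abbreviation bracket :: "'a \<Rightarrow> 'a \<Rightarrow> 'a" (\<open>\<lblot>_, _\<rblot>\<close>)
  where "\<lblot>x, y\<rblot> \<equiv> x \<cdot> y - y \<cdot> x"

end

locale hom_pre_malcev_algebra = vector_space scale + product_commutator dot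
  for scale :: "'k::field_char_0 \<Rightarrow> 'a::ab_group_add \<Rightarrow> 'a"
    and dot :: "'a \<Rightarrow> 'a \<Rightarrow> 'a" (infixl \<open>\<cdot>\<close> 70) +
  fixes \<alpha> :: "'a \<Rightarrow> 'a"
  assumes bilinear_dot: "bilinear_map scale scale scale (\<cdot>)"
    and linear_alpha: "Vector_Spaces.linear scale scale \<alpha>"
    and pre_malcev:
      "\<alpha> \<lblot>y, z\<rblot> \<cdot> \<alpha> (x \<cdot> t) + \<lblot>\<lblot>x, y\<rblot>, \<alpha> z\<rblot> \<cdot> \<alpha> (\<alpha> t) + \<alpha> (\<alpha> y) \<cdot> (\<lblot>x, z\<rblot> \<cdot> \<alpha> t)
        - \<alpha> (\<alpha> x) \<cdot> (\<alpha> y \<cdot> (z \<cdot> t)) + \<alpha> (\<alpha> z) \<cdot> (\<alpha> x \<cdot> (y \<cdot> t)) = 0"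

locale multiplicative_hom_pre_malcev_algebra = hom_pre_malcev_algebra scale dot \<alpha>
  for scale :: "'k::field_char_0 \<Rightarrow> 'a::ab_group_add \<Rightarrow> 'a"
    and dot :: "'a \<Rightarrow> 'a \<Rightarrow> 'a" and \<alpha> :: "'a \<Rightarrow> 'a" +
  assumes alpha_dot: "\<alpha> (dot x y) = dot (\<alpha> x) (\<alpha> y)"

text \<open>The identities between endomorphisms of \<open>V\<close> are stated pointwise, so a composition
  \<open>f g\<close> becomes \<open>f (g a)\<close>; \<open>\<rho> x a\<close> stands for \<open>\<rho>(x)(a)\<close> with \<open>\<rho> = l - r\<close>.\<close>

locale action_difference =
  fixes l r :: "'a \<Rightarrow> 'v \<Rightarrow> 'v::ab_group_add"
begin

abbreviation \<rho> :: "'a \<Rightarrow> 'v \<Rightarrow> 'v"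
  where "\<rho> x a \<equiv> l x a - r x a"

end

locale hom_pre_malcev_representation =
  A: hom_pre_malcev_algebra scaleA dot \<alpha> + V: vector_space scaleV + action_difference l r
  for scaleA :: "'k::field_char_0 \<Rightarrow> 'a::ab_group_add \<Rightarrow> 'a"
    and dot :: "'a \<Rightarrow> 'a \<Rightarrow> 'a" (infixl \<open>\<cdot>\<close> 70) and \<alpha> :: "'a \<Rightarrow> 'a"
    and scaleV :: "'k \<Rightarrow> 'v::ab_group_add \<Rightarrow> 'v"
    and l r :: "'a \<Rightarrow> 'v \<Rightarrow> 'v" +
  fixes \<beta> :: "'v \<Rightarrow> 'v"
  assumes linear_beta: "Vector_Spaces.linear scaleV scaleV \<beta>"
    and bilinear_l: "bilinear_map scaleA scaleV scaleV l"
    and bilinear_r: "bilinear_map scaleA scaleV scaleV r"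
    and l_beta: "l (\<alpha> x) (\<beta> a) = \<beta> (l x a)"
    and r_beta: "r (\<alpha> x) (\<beta> a) = \<beta> (r x a)"
    and representation_1:
      "l (A.bracket (A.bracket x y) (\<alpha> z)) (\<beta> (\<beta> a)) =
        l (\<alpha> (\<alpha> x)) (l (\<alpha> y) (l z a)) - l (\<alpha> (\<alpha> z)) (l (\<alpha> x) (l y a))
        + l (\<alpha> (\<alpha> y)) (l (A.bracket z x) (\<beta> a)) - l (\<alpha> (A.bracket y z)) (l (\<alpha> x) (\<beta> a))"
    and representation_2:
      "r (\<alpha> (\<alpha> x)) (\<rho> (\<alpha> y) (\<rho> z a)) - r (\<alpha> z \<cdot> (y \<cdot> x)) (\<beta> (\<beta> a))
        + l (\<alpha> (\<alpha> y)) (r (z \<cdot> x) (\<beta> a)) + l (\<alpha> (A.bracket z y)) (r (\<alpha> x) (\<beta> a))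
        - l (\<alpha> (\<alpha> z)) (r (\<alpha> x) (\<rho> y a)) = 0"
    and representation_3:
      "l (\<alpha> (\<alpha> y)) (l (\<alpha> z) (r x a)) - r (\<alpha> (\<alpha> x)) (\<rho> (\<alpha> y) (\<rho> z a))
        - l (\<alpha> (\<alpha> z)) (r (y \<cdot> x) (\<beta> a)) - r (\<alpha> (z \<cdot> x)) (\<rho> (\<alpha> y) (\<beta> a))
        + r (A.bracket z y \<cdot> \<alpha> x) (\<beta> (\<beta> a)) = 0"
    and representation_4:
      "r (\<alpha> y \<cdot> (z \<cdot> x)) (\<beta> (\<beta> a)) + r (\<alpha> (\<alpha> x)) (\<rho> (A.bracket y z) (\<beta> a))
        - l (\<alpha> (\<alpha> y)) (l (\<alpha> z) (r x a)) + r (\<alpha> (y \<cdot> x)) (\<rho> (\<alpha> z) (\<beta> a))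
        + l (\<alpha> (\<alpha> z)) (r (\<alpha> x) (\<rho> y a)) = 0"

locale hom_pre_malcev_O_operator =
  hom_pre_malcev_representation scaleA dot \<alpha> scaleV l r \<beta>
  for scaleA :: "'k::field_char_0 \<Rightarrow> 'a::ab_group_add \<Rightarrow> 'a"
    and dot :: "'a \<Rightarrow> 'a \<Rightarrow> 'a" and \<alpha> :: "'a \<Rightarrow> 'a"
    and scaleV :: "'k \<Rightarrow> 'v::ab_group_add \<Rightarrow> 'v"
    and l r :: "'a \<Rightarrow> 'v \<Rightarrow> 'v" and \<beta> :: "'v \<Rightarrow> 'v" +
  fixes T :: "'v \<Rightarrow> 'a"
  assumes linear_T: "Vector_Spaces.linear scaleV scaleA T"
    and T_beta: "T (\<beta> a) = \<alpha> (T a)"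
    and T_dot: "dot (T a) (T b) = T (l (T a) b + r (T b) a)"


subsection \<open>Products on \<open>V\<close> induced by an O-operator\<close>

text \<open>The two products of the Hom-M-dendriform algebra associated to an O-operator \<open>T\<close> of a
  Hom-pre-Malcev algebra with respect to \<open>(V, l, r, \<beta>)\<close>.\<close>

definition dendriform_right :: "('a \<Rightarrow> 'v \<Rightarrow> 'v) \<Rightarrow> ('v \<Rightarrow> 'a) \<Rightarrow> 'v \<Rightarrow> 'v \<Rightarrow> 'v"
  where "dendriform_right r T a b = r (T b) a"

definition dendriform_left :: "('a \<Rightarrow> 'v \<Rightarrow> 'v) \<Rightarrow> ('v \<Rightarrow> 'a) \<Rightarrow> 'v \<Rightarrow> 'v \<Rightarrow> 'v"
  where "dendriform_left l T a b = l (T a) b"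

text \<open>The four products induced by an O-operator of a Hom-pre-alternative algebra.\<close>

definition se_product :: "('a \<Rightarrow> 'v \<Rightarrow> 'v) \<Rightarrow> ('v \<Rightarrow> 'a) \<Rightarrow> 'v \<Rightarrow> 'v \<Rightarrow> 'v"
  where "se_product Lsucc T a b = Lsucc (T a) b"

definition ne_product :: "('a \<Rightarrow> 'v \<Rightarrow> 'v) \<Rightarrow> ('v \<Rightarrow> 'a) \<Rightarrow> 'v \<Rightarrow> 'v \<Rightarrow> 'v"
  where "ne_product Rsucc T a b = Rsucc (T b) a"

definition sw_product :: "('a \<Rightarrow> 'v \<Rightarrow> 'v) \<Rightarrow> ('v \<Rightarrow> 'a) \<Rightarrow> 'v \<Rightarrow> 'v \<Rightarrow> 'v"
  where "sw_product Lprec T a b = Lprec (T a) b"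

definition nw_product :: "('a \<Rightarrow> 'v \<Rightarrow> 'v) \<Rightarrow> ('v \<Rightarrow> 'a) \<Rightarrow> 'v \<Rightarrow> 'v \<Rightarrow> 'v"
  where "nw_product Rprec T a b = Rprec (T b) a"

end

theory Submission
  imports Defs
begin

text \<open>
  The result is an instance of one general principle: \<open>x \<cdot> y = x \<succ> y - y \<prec> x\<close> turns every
  Hom-pre-alternative algebra into a multiplicative Hom-pre-Malcev algebra
  (\<open>multiplicative_hom_pre_malcev\<close>). A representation on \<open>V\<close> is by definition a
  Hom-pre-alternative structure on \<open>A \<oplus> V\<close>, and there the product \<open>\<cdot>\<close> is
  \<open>(x + a) \<cdot> (y + b) = x \<cdot> y + l x b + r y a\<close> with \<open>l = L\<^sub>\<succ> - R\<^sub>\<prec>\<close> and \<open>r = R\<^sub>\<succ> - L\<^sub>\<prec>\<close>. Each of the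
  four identities that define a representation of a Hom-pre-Malcev algebra is the pre-Malcev
  identity of \<open>A \<oplus> V\<close> with one of its four variables in \<open>V\<close> and the other three in \<open>A\<close>. The
  O-operator condition for \<open>\<cdot>\<close> is the one for \<open>\<succ>\<close> minus the one for \<open>\<prec>\<close> with \<open>a\<close> and \<open>b\<close>
  exchanged, and the formulas for the products on \<open>V\<close> only restate the definitions of \<open>l\<close> and \<open>r\<close>.

  The general principle is in turn a module version of the fact that the commutator of a
  Hom-alternative algebra satisfies the Hom-Malcev identity. The axioms of a Hom-pre-alternative
  algebra say that \<open>\<star>\<close> is Hom-alternative and that \<open>A\<close> with left action \<open>\<succ>\<close> and right action \<open>\<prec>\<close>
  is a bimodule over it, that is, that the split null extension of \<open>(A, \<star>)\<close> by this bimodule is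
  Hom-alternative (\<open>double_hom_alternative\<close>). The commutator of an element \<open>x\<close> of the algebra and
  an element \<open>t\<close> of the module is \<open>x \<succ> t - t \<prec> x = x \<cdot> t\<close>, and \<open>x \<star> y - y \<star> x = x \<cdot> y - y \<cdot> x\<close>. So
  the Hom-Malcev identity for three elements of the algebra and one of the module is the
  pre-Malcev identity.

  There remains the Hom-Malcev identity (\<open>commutator_hom_malcev\<close>). As for alternative algebras,
  the Jacobian of the commutator is six times the associator, and the Bruck-Kleinfeld function
  \<open>(wx, y, z) - x(w, y, z) - (x, y, z)w\<close> is alternating in its four arguments; together they
  reduce the identity to counting. Twisting by \<open>\<alpha>\<close> changes nothing in this, because
  \<open>\<alpha>\<close> is multiplicative: in all monomials of degree four a factor at depth \<open>d\<close> carries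
  \<open>\<alpha>\<close> to the power \<open>3 - d\<close>.
\<close>

section \<open>Linear and bilinear maps\<close>

lemma linear_diff_map:
  assumes "Vector_Spaces.linear s1 s2 f" and "Vector_Spaces.linear s1 s2 g"
  shows "Vector_Spaces.linear s1 s2 (\<lambda>x. f x - g x)"
proof -
  interpret f: Vector_Spaces.linear s1 s2 f by fact
  interpret g: Vector_Spaces.linear s1 s2 g by fact
  show ?thesis
    by unfold_locales (simp_all add: f.add g.add f.scale g.scale f.vs2.scale_right_diff_distrib)
qed

lemma linear_add_map:
  assumes "Vector_Spaces.linear s1 s2 f" and "Vector_Spaces.linear s1 s2 g"
  shows "Vector_Spaces.linear s1 s2 (\<lambda>x. f x + g x)"
proof -
  interpret f: Vector_Spaces.linear s1 s2 f by fact
  interpret g: Vector_Spaces.linear s1 s2 g by fact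
  show ?thesis
    by unfold_locales (simp_all add: f.add g.add f.scale g.scale f.vs2.scale_right_distrib)
qed

lemma bilinear_map_diff:
  assumes "bilinear_map s1 s2 s3 f" and "bilinear_map s1 s2 s3 g"
  shows "bilinear_map s1 s2 s3 (\<lambda>x y. f x y - g x y)"
  using assms by (simp add: bilinear_map_def linear_diff_map)

lemma bilinear_map_add:
  assumes "bilinear_map s1 s2 s3 f" and "bilinear_map s1 s2 s3 g"
  shows "bilinear_map s1 s2 s3 (\<lambda>x y. f x y + g x y)"
  using assms by (simp add: bilinear_map_def linear_add_map)

lemma bilinear_map_flip:
  "bilinear_map s1 s2 s3 f \<Longrightarrow> bilinear_map s2 s1 s3 (\<lambda>x y. f y x)"
  by (simp add: bilinear_map_def)

lemma linear_map_simps: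
  assumes "Vector_Spaces.linear s1 s2 f"
  shows "f (x + y) = f x + f y" and "f (x - y) = f x - f y"
    and "f (- x) = - f x" and "f 0 = 0" and "f (s1 c x) = s2 c (f x)"
proof -
  interpret f: Vector_Spaces.linear s1 s2 f by fact
  show "f (x + y) = f x + f y" and "f (x - y) = f x - f y"
    and "f (- x) = - f x" and "f 0 = 0" and "f (s1 c x) = s2 c (f x)"
    by (fact f.add f.diff f.neg f.zero f.scale)+
qed

lemma bilinear_map_simps:
  assumes "bilinear_map s1 s2 s3 f"
  shows "f (x + x') y = f x y + f x' y" and "f x (y + y') = f x y + f x y'"
    and "f (x - x') y = f x y - f x' y" and "f x (y - y') = f x y - f x y'"
    and "f (- x) y = - f x y" and "f x (- y) = - f x y"
    and "f 0 y = 0" and "f x 0 = 0"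
    and "f (s1 c x) y = s3 c (f x y)" and "f x (s2 c y) = s3 c (f x y)"
proof -
  have l: "Vector_Spaces.linear s1 s3 (\<lambda>x. f x y)"
    and r: "Vector_Spaces.linear s2 s3 (\<lambda>y. f x y)" for x y
    using assms by (simp_all add: bilinear_map_def)
  show "f (x + x') y = f x y + f x' y" "f (x - x') y = f x y - f x' y"
    "f (- x) y = - f x y" "f 0 y = 0" "f (s1 c x) y = s3 c (f x y)"
    by (fact linear_map_simps[OF l])+
  show "f x (y + y') = f x y + f x y'" "f x (y - y') = f x y - f x y'"
    "f x (- y) = - f x y" "f x 0 = 0" "f x (s2 c y) = s3 c (f x y)"
    by (fact linear_map_simps[OF r])+
qed

section \<open>The Hom-Malcev identity in Hom-alternative algebras\<close>

context hom_alternative_algebra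
begin

lemmas mul_simps = bilinear_map_simps[OF bilinear_mul]
lemmas alpha_simps = linear_map_simps[OF linear_alpha]

abbreviation "as \<equiv> hom_associator mul \<alpha>"
abbreviation "commutator x y \<equiv> mul x y - mul y x"

lemma associator_swap_12: "as y x z = - as x y z"
  using left_alternative[of x y z] by (metis add.inverse_unique)

lemma associator_swap_23: "as x z y = - as x y z"
  using right_alternative[of x y z] by (metis add.inverse_unique)

lemma associator_rotate: "as y z x = as x y z"
  by (metis associator_swap_12 associator_swap_23 minus_minus)

lemma associator_simps:
  "as (x + x') y z = as x y z + as x' y z"
  "as (x - x') y z = as x y z - as x' y z"
  by (simp_all add: hom_associator_def mul_simps alpha_simps algebra_simps)

text \<open>The two copies of \<open>(wx)(yz)\<close> on the left cancel by multiplicativity of \<open>\<alpha>\<close>, and the other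
  four bracketings of \<open>w x y z\<close> occur once on each side.\<close>

lemma teichmueller:
  "as (mul w x) (\<alpha> y) (\<alpha> z) - as (\<alpha> w) (mul x y) (\<alpha> z) + as (\<alpha> w) (\<alpha> x) (mul y z)
    = mul (\<alpha> (\<alpha> w)) (as x y z) + mul (as w x y) (\<alpha> (\<alpha> z))"
  by (simp add: hom_associator_def mul_simps alpha_mul)

text \<open>The Hom version of the Bruck-Kleinfeld function: the error in expanding an associator with
  a product in its first argument.\<close>

definition kleinfeld where
  "kleinfeld w x y z = as (mul w x) (\<alpha> y) (\<alpha> z)
     - mul (\<alpha> (\<alpha> x)) (as w y z) - mul (as x y z) (\<alpha> (\<alpha> w))"

text \<open>The right-hand side that remains when the three Kleinfeld functions in the Teichmueller
  identity are collected. It changes sign when its arguments are rotated, which is visible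
  from its shape.\<close>

definition assoc_cycle where
  "assoc_cycle w x y z = commutator (\<alpha> (\<alpha> w)) (as x y z) - commutator (\<alpha> (\<alpha> x)) (as y z w)
     + commutator (\<alpha> (\<alpha> y)) (as z w x) - commutator (\<alpha> (\<alpha> z)) (as w x y)"

text \<open>This is the Teichmueller identity, with the cyclic invariance of the associator used to
  bring every product of two variables into the first argument.\<close>

lemma kleinfeld_cyclic_sum:
  "kleinfeld w x y z - kleinfeld x y z w + kleinfeld y z w x = assoc_cycle w x y z"
proof -
  have "as (mul w x) (\<alpha> y) (\<alpha> z) - as (mul x y) (\<alpha> z) (\<alpha> w) + as (mul y z) (\<alpha> w) (\<alpha> x)
      = mul (\<alpha> (\<alpha> w)) (as x y z) + mul (as w x y) (\<alpha> (\<alpha> z))"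
    using teichmueller[of w x y z]
    by (simp only: associator_rotate[of "mul x y" "\<alpha> z" "\<alpha> w", symmetric]
        associator_rotate[of "\<alpha> w" "mul x y" "\<alpha> z"]
        associator_rotate[of "\<alpha> w" "\<alpha> x" "mul y z"]
        associator_rotate[of "mul y z" "\<alpha> w" "\<alpha> x"])
  moreover have "as w y z = as y z w" "as x z w = as z w x" "as y w x = as w x y"
    by (simp_all add: associator_rotate)
  ultimately show ?thesis
    by (simp add: kleinfeld_def assoc_cycle_def algebra_simps)
qed

text \<open>The alternating sum of three consecutive rotations changes sign under rotation. Adding it
  to its own rotation leaves only the first and the last term, so their sum vanishes.
  Since a four-cycle is an odd permutation, this is half of the proof that \<open>kleinfeld\<close> is
  alternating; the swap of the last two arguments, which is inherited from the associator, is the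
  other half.\<close>

lemma kleinfeld_rotate: "kleinfeld x y z w = - kleinfeld w x y z"
proof -
  have "kleinfeld w x y z + kleinfeld z w x y
      = assoc_cycle x y z w + assoc_cycle w x y z" for w x y z
    by (simp flip: kleinfeld_cyclic_sum)
  then have "kleinfeld w x y z + kleinfeld z w x y = 0" for w x y z
    by (simp add: assoc_cycle_def)
  from this[of x y z w] show ?thesis
    by (simp add: eq_neg_iff_add_eq_0)
qed

lemma kleinfeld_swap_34: "kleinfeld w x z y = - kleinfeld w x y z"
  by (simp add: associator_swap_23[of _ y z] associator_swap_23[of _ "\<alpha> y" "\<alpha> z"]
      kleinfeld_def mul_simps algebra_simps)

lemma kleinfeld_swap_12: "kleinfeld x w y z = - kleinfeld w x y z"
  by (metis kleinfeld_rotate kleinfeld_swap_34)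

lemma kleinfeld_swap_23: "kleinfeld w y x z = - kleinfeld w x y z"
  by (metis kleinfeld_rotate kleinfeld_swap_34)

lemma assoc_cycle_eq:
  "assoc_cycle w x y z = kleinfeld w x y z + kleinfeld w x y z + kleinfeld w x y z"
  using kleinfeld_cyclic_sum[of w x y z] kleinfeld_rotate[of x y z w]
    kleinfeld_rotate[of y z w x] by simp

text \<open>Antisymmetrising the definition of \<open>kleinfeld\<close> in the first two arguments. This is how
  associators with a commutator inside are removed below.\<close>

lemma associator_commutator:
  "as (commutator w x) (\<alpha> y) (\<alpha> z) = kleinfeld w x y z + kleinfeld w x y z
     - commutator (\<alpha> (\<alpha> w)) (as x y z) + commutator (\<alpha> (\<alpha> x)) (as w y z)"
  using kleinfeld_swap_12[of x w y z]
  by (simp add: kleinfeld_def associator_simps algebra_simps)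

definition jacobian where
  "jacobian x y z = commutator (commutator x y) (\<alpha> z)
     + commutator (commutator y z) (\<alpha> x) + commutator (commutator z x) (\<alpha> y)"

text \<open>The twelve terms of the Jacobian are those of the alternating sum of the associator over
  the six orders of the arguments, and all six summands agree.\<close>

lemma jacobian_eq: "jacobian x y z = scale 6 (as x y z)"
proof -
  have "jacobian x y z = as x y z + as y z x + as z x y - as y x z - as x z y - as z y x"
    by (simp add: jacobian_def hom_associator_def mul_simps algebra_simps)
  also have "\<dots> = as x y z + as x y z + as x y z + as x y z + as x y z + as x y z"
    using associator_swap_12[of x y z] associator_swap_23[of x y z]
      associator_rotate[of x y z] associator_rotate[of z x y]
      associator_swap_12[of y z x]
    by simp
  also have "\<dots> = scale (1 + 1 + 1 + 1 + 1 + 1) (as x y z)"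
    by (simp only: scale_left_distrib scale_one)
  finally show ?thesis by simp
qed

text \<open>By skew symmetry of the commutator and multiplicativity of \<open>\<alpha>\<close>, the left-hand side is a
  combination of three Jacobians with a commutator inside and two commutators with a Jacobian
  inside. Up to the common factor \<open>6\<close>, Jacobians are associators. By \<open>associator_commutator\<close> the
  first three contribute \<open>-6\<close> times the Kleinfeld function, and all remaining terms add up to
  twice \<open>assoc_cycle\<close>, which is \<open>6\<close> times the Kleinfeld function.\<close>

theorem commutator_hom_malcev:
  "commutator (\<alpha> (commutator y z)) (\<alpha> (commutator x t))
     + commutator (commutator (commutator x y) (\<alpha> z)) (\<alpha> (\<alpha> t))
     + commutator (\<alpha> (\<alpha> y)) (commutator (commutator x z) (\<alpha> t))
     - commutator (\<alpha> (\<alpha> x)) (commutator (\<alpha> y) (commutator z t))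
     + commutator (\<alpha> (\<alpha> z)) (commutator (\<alpha> x) (commutator y t)) = 0"
    (is "?E = 0")
proof -
  have "?E = - jacobian (commutator y z) (\<alpha> x) (\<alpha> t) - jacobian (commutator z x) (\<alpha> y) (\<alpha> t)
      - jacobian (commutator y t) (\<alpha> z) (\<alpha> x) - commutator (\<alpha> (\<alpha> t)) (jacobian x y z)
      + commutator (\<alpha> (\<alpha> x)) (jacobian y z t)"
    by (simp add: jacobian_def mul_simps alpha_simps alpha_mul algebra_simps)
  also have "\<dots> = scale 6 (- as (commutator y z) (\<alpha> x) (\<alpha> t) - as (commutator z x) (\<alpha> y) (\<alpha> t)
      - as (commutator y t) (\<alpha> z) (\<alpha> x) - commutator (\<alpha> (\<alpha> t)) (as x y z)
      + commutator (\<alpha> (\<alpha> x)) (as y z t))"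
    by (simp add: jacobian_eq mul_simps scale_right_distrib scale_right_diff_distrib)
  also have "- as (commutator y z) (\<alpha> x) (\<alpha> t) - as (commutator z x) (\<alpha> y) (\<alpha> t)
      - as (commutator y t) (\<alpha> z) (\<alpha> x) - commutator (\<alpha> (\<alpha> t)) (as x y z)
      + commutator (\<alpha> (\<alpha> x)) (as y z t) = 0"
  proof -
    let ?f = "kleinfeld x y z t"
    \<comment> \<open>all three orders are even permutations of \<open>x, y, z, t\<close>\<close>
    have f: "kleinfeld y z x t = ?f" "kleinfeld z x y t = ?f" "kleinfeld y t z x = ?f"
      by (metis kleinfeld_swap_12 kleinfeld_swap_23 kleinfeld_swap_34 minus_minus)+
    \<comment> \<open>each associator is brought to the order in which it occurs in \<open>assoc_cycle\<close>\<close>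
    have a: "as z x t = - as z t x" "as y x t = - as t x y" "as x y t = as t x y"
       "as z y t = - as y z t" "as t z x = - as z t x" "as y z x = as x y z"
      by (metis associator_swap_12 associator_swap_23 minus_minus)+
    have "- as (commutator y z) (\<alpha> x) (\<alpha> t) - as (commutator z x) (\<alpha> y) (\<alpha> t)
        - as (commutator y t) (\<alpha> z) (\<alpha> x) - commutator (\<alpha> (\<alpha> t)) (as x y z)
      + commutator (\<alpha> (\<alpha> x)) (as y z t)
      = assoc_cycle x y z t + assoc_cycle x y z t - (?f + ?f + ?f + ?f + ?f + ?f)"
      by (simp add: associator_commutator f a mul_simps assoc_cycle_def algebra_simps)
    then show ?thesis
      by (simp add: assoc_cycle_eq)
  qed
  finally show ?thesis by simp
qed

end

section \<open>Hom-pre-alternative algebras are Hom-pre-Malcev\<close>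

lemma bilinear_map_semidirect_product:
  assumes A: "vector_space sA" and V: "vector_space sV"
    and mul: "bilinear_map sA sA sA mul"
    and L: "bilinear_map sA sV sV L" and R: "bilinear_map sA sV sV R"
  shows "bilinear_map (module_prod.scale sA sV) (module_prod.scale sA sV) (module_prod.scale sA sV)
    (semidirect_product mul L R)"
proof -
  interpret vector_space_prod sA sV
    using A V by (simp add: vector_space_prod_def vector_space_pair_def)
  note simps = semidirect_product_def scale_prod bilinear_map_simps[OF mul]
    bilinear_map_simps[OF L] bilinear_map_simps[OF R] vs2.scale_right_distrib
  show ?thesis
    unfolding bilinear_map_def
    by (auto simp: Vector_Spaces.linear_iff simps p.vector_space_axioms)
qed

lemma linear_map_prod:
  assumes f: "Vector_Spaces.linear sA sA f" and g: "Vector_Spaces.linear sV sV g"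
  shows "Vector_Spaces.linear (module_prod.scale sA sV) (module_prod.scale sA sV) (map_prod f g)"
proof -
  interpret f: Vector_Spaces.linear sA sA f by fact
  interpret g: Vector_Spaces.linear sV sV g by fact
  interpret vector_space_prod sA sV by unfold_locales
  show ?thesis
    by unfold_locales (auto simp: scale_def f.add f.scale g.add g.scale)
qed

context hom_pre_alternative_algebra
begin

lemmas alpha_simps = linear_map_simps[OF linear_alpha]
lemmas prec_simps = bilinear_map_simps[OF bilinear_prec]
lemmas succ_simps = bilinear_map_simps[OF bilinear_succ]

text \<open>The associator of \<open>\<star>\<close> is the sum of a left, a middle and a right associator of \<open>\<prec>\<close> and
  \<open>\<succ>\<close>. The first axiom exchanges the middle one for minus the right one with its first two
  arguments swapped, and the third makes the left one skew in them, so the required identity is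
  the sum of three instances of these axioms, which \<open>arg_cong2\<close> forms. The next lemma uses the
  other two axioms in the same way.\<close>

lemma star_left_alternative:
  "hom_associator (\<star>) \<alpha> x y z + hom_associator (\<star>) \<alpha> y x z = 0"
  using arg_cong2[of _ _ _ _ "(+)", OF arg_cong2[of _ _ _ _ "(+)", OF pre_alternative_3[of x y z]
    pre_alternative_1[of x y z]] pre_alternative_1[of y x z]]
  by (simp add: hom_associator_def prec_simps succ_simps algebra_simps)

lemma star_right_alternative:
  "hom_associator (\<star>) \<alpha> x y z + hom_associator (\<star>) \<alpha> x z y = 0"
  using arg_cong2[of _ _ _ _ "(+)", OF arg_cong2[of _ _ _ _ "(+)", OF pre_alternative_4[of x y z]
    pre_alternative_2[of x y z]] pre_alternative_2[of x z y]]
  by (simp add: hom_associator_def prec_simps succ_simps algebra_simps)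

text \<open>On pairs, the two alternative laws split into one identity for \<open>\<star>\<close> and one for each of the
  three positions that the module element can have. The latter are exactly the axioms of a
  Hom-pre-alternative algebra.\<close>

lemma double_hom_alternative:
  "hom_alternative_algebra (module_prod.scale scale scale)
     (semidirect_product (\<star>) (\<succ>) (\<lambda>y a. a \<prec> y)) (map_prod \<alpha> \<alpha>)"
proof -
  interpret P: vector_space_prod scale scale by unfold_locales
  have sum: "bilinear_map scale scale scale (\<star>)"
    by (intro bilinear_map_add bilinear_prec bilinear_succ)
  note simps = hom_associator_def semidirect_product_def prec_simps succ_simps
  show ?thesis
  proof (intro hom_alternative_algebra.intro hom_alternative_algebra_axioms.intro)
    show "vector_space (module_prod.scale scale scale)"
      by (fact P.p.vector_space_axioms)
    show "bilinear_map (module_prod.scale scale scale) (module_prod.scale scale scale)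
      (module_prod.scale scale scale) (semidirect_product (\<star>) (\<succ>) (\<lambda>y a. a \<prec> y))"
      by (intro bilinear_map_semidirect_product sum bilinear_succ
          bilinear_map_flip[OF bilinear_prec]) unfold_locales
    show "Vector_Spaces.linear (module_prod.scale scale scale) (module_prod.scale scale scale)
      (map_prod \<alpha> \<alpha>)"
      by (intro linear_map_prod linear_alpha)
  next
    fix X Y :: "'a \<times> 'a"
    show "map_prod \<alpha> \<alpha> (semidirect_product (\<star>) (\<succ>) (\<lambda>y a. a \<prec> y) X Y)
      = semidirect_product (\<star>) (\<succ>) (\<lambda>y a. a \<prec> y) (map_prod \<alpha> \<alpha> X) (map_prod \<alpha> \<alpha> Y)"
      by (cases X; cases Y)
        (simp add: semidirect_product_def alpha_simps alpha_prec alpha_succ)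
  next
    fix X Y Z :: "'a \<times> 'a"
    obtain x a y b z c where XYZ: "X = (x, a)" "Y = (y, b)" "Z = (z, c)"
      by (cases X; cases Y; cases Z)
    show "hom_associator (semidirect_product (\<star>) (\<succ>) (\<lambda>y a. a \<prec> y)) (map_prod \<alpha> \<alpha>) X Y Z
      + hom_associator (semidirect_product (\<star>) (\<succ>) (\<lambda>y a. a \<prec> y)) (map_prod \<alpha> \<alpha>) Y X Z = 0"
      using star_left_alternative[of x y z]
        arg_cong2[of _ _ _ _ "(+)", OF arg_cong2[of _ _ _ _ "(+)", OF pre_alternative_3[of x y c]
        pre_alternative_1[of x b z]] pre_alternative_1[of y a z]]
      by (simp add: XYZ simps algebra_simps zero_prod_def)
    show "hom_associator (semidirect_product (\<star>) (\<succ>) (\<lambda>y a. a \<prec> y)) (map_prod \<alpha> \<alpha>) X Y Z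
      + hom_associator (semidirect_product (\<star>) (\<succ>) (\<lambda>y a. a \<prec> y)) (map_prod \<alpha> \<alpha>) X Z Y = 0"
      using star_right_alternative[of x y z]
        arg_cong2[of _ _ _ _ "(+)", OF arg_cong2[of _ _ _ _ "(+)", OF pre_alternative_4[of a y z]
        pre_alternative_2[of x b z]] pre_alternative_2[of x c y]]
      by (simp add: XYZ simps algebra_simps zero_prod_def)
  qed
qed

text \<open>The Hom-Malcev identity in the double, with \<open>t\<close> in the module and \<open>x\<close>, \<open>y\<close>, \<open>z\<close> in the
  algebra.\<close>

theorem multiplicative_hom_pre_malcev:
  "multiplicative_hom_pre_malcev_algebra scale (\<lambda>x y. x \<succ> y - y \<prec> x) \<alpha>"
proof (intro multiplicative_hom_pre_malcev_algebra.intro hom_pre_malcev_algebra.intro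
    hom_pre_malcev_algebra_axioms.intro multiplicative_hom_pre_malcev_algebra_axioms.intro)
  show "vector_space scale"
    by (fact vector_space_axioms)
  show "bilinear_map scale scale scale (\<lambda>x y. x \<succ> y - y \<prec> x)"
    by (intro bilinear_map_diff bilinear_succ bilinear_map_flip[OF bilinear_prec])
  show "Vector_Spaces.linear scale scale \<alpha>"
    by (fact linear_alpha)
  show "\<alpha> (x \<succ> y - y \<prec> x) = \<alpha> x \<succ> \<alpha> y - \<alpha> y \<prec> \<alpha> x" for x y
    by (simp add: alpha_simps alpha_prec alpha_succ)
next
  fix y z x t
  interpret B: hom_alternative_algebra "module_prod.scale scale scale"
    "semidirect_product (\<star>) (\<succ>) (\<lambda>y a. a \<prec> y)" "map_prod \<alpha> \<alpha>"
    by (fact double_hom_alternative)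
  let ?d = "\<lambda>x y. x \<succ> y - y \<prec> x"
  let ?c = "\<lambda>x y. ?d x y - ?d y x"
  \<comment> \<open>Naming the two operations keeps them folded, so that the identity in the double can be
    read off term by term.\<close>
  define d where "d u v = u \<succ> v - v \<prec> u" for u v
  define c where "c X Y = semidirect_product (\<star>) (\<succ>) (\<lambda>y a. a \<prec> y) X Y
    - semidirect_product (\<star>) (\<succ>) (\<lambda>y a. a \<prec> y) Y X" for X Y
  have c_left: "c (u, 0) (v, 0) = (d u v - d v u, 0)"
    and c_mixed: "c (u, 0) (0, v) = (0, d u v)" for u v
    by (simp_all add: c_def d_def semidirect_product_def prec_simps succ_simps)
  have \<alpha>_left: "map_prod \<alpha> \<alpha> (u, 0) = (\<alpha> u, 0)"
    and \<alpha>_right: "map_prod \<alpha> \<alpha> (0, u) = (0, \<alpha> u)" for u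
    by (simp_all add: alpha_simps)
  have "d (\<alpha> (d y z - d z y)) (\<alpha> (d x t))
      + d (d (d x y - d y x) (\<alpha> z) - d (\<alpha> z) (d x y - d y x)) (\<alpha> (\<alpha> t))
      + d (\<alpha> (\<alpha> y)) (d (d x z - d z x) (\<alpha> t)) - d (\<alpha> (\<alpha> x)) (d (\<alpha> y) (d z t))
      + d (\<alpha> (\<alpha> z)) (d (\<alpha> x) (d y t)) = 0"
    using B.commutator_hom_malcev[of "(y, 0)" "(z, 0)" "(x, 0)" "(0, t)", folded c_def]
    unfolding c_left c_mixed \<alpha>_left \<alpha>_right
    by (simp add: zero_prod_def)
  then show "?d (\<alpha> (?c y z)) (\<alpha> (?d x t)) + ?d (?c (?c x y) (\<alpha> z)) (\<alpha> (\<alpha> t))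
      + ?d (\<alpha> (\<alpha> y)) (?d (?c x z) (\<alpha> t)) - ?d (\<alpha> (\<alpha> x)) (?d (\<alpha> y) (?d z t))
      + ?d (\<alpha> (\<alpha> z)) (?d (\<alpha> x) (?d y t)) = 0"
    by (simp only: d_def)
qed

end

section \<open>Representations and O-operators\<close>

text \<open>Multiplicativity of \<open>map_prod \<alpha> \<beta>\<close> gives the compatibility of \<open>l\<close> and \<open>r\<close> with \<open>\<beta>\<close>. The four
  remaining identities are the pre-Malcev identity with, in this order, its variable \<open>t\<close>, \<open>x\<close>,
  \<open>y\<close> and \<open>z\<close> in \<open>V\<close>.\<close>

lemma hom_pre_malcev_representation_if_semidirect:
  fixes scaleA :: "'k::field_char_0 \<Rightarrow> 'a::ab_group_add \<Rightarrow> 'a"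
    and scaleV :: "'k \<Rightarrow> 'v::ab_group_add \<Rightarrow> 'v"
  assumes A: "hom_pre_malcev_algebra scaleA dot \<alpha>" and V: "vector_space scaleV"
    and \<beta>: "Vector_Spaces.linear scaleV scaleV \<beta>"
    and l: "bilinear_map scaleA scaleV scaleV l" and r: "bilinear_map scaleA scaleV scaleV r"
    and S: "multiplicative_hom_pre_malcev_algebra (module_prod.scale scaleA scaleV)
      (semidirect_product dot l r) (map_prod \<alpha> \<beta>)"
  shows "hom_pre_malcev_representation scaleA dot \<alpha> scaleV l r \<beta>"
proof -
  interpret A: hom_pre_malcev_algebra scaleA dot \<alpha> by (fact A)
  interpret V: vector_space scaleV by (fact V)
  interpret S: multiplicative_hom_pre_malcev_algebra "module_prod.scale scaleA scaleV"
    "semidirect_product dot l r" "map_prod \<alpha> \<beta>" by (fact S)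
  note dot_simps = bilinear_map_simps[OF A.bilinear_dot]
  note l_simps = bilinear_map_simps[OF l] and r_simps = bilinear_map_simps[OF r]
  note \<alpha>_simps = linear_map_simps[OF A.linear_alpha] and \<beta>_simps = linear_map_simps[OF \<beta>]
  have l_beta: "\<beta> (l x a) = l (\<alpha> x) (\<beta> a)" for x a
    using S.alpha_dot[of "(x, 0)" "(0, a)"]
    by (simp add: semidirect_product_def r_simps \<alpha>_simps \<beta>_simps)
  have r_beta: "\<beta> (r x a) = r (\<alpha> x) (\<beta> a)" for x a
    using S.alpha_dot[of "(0, a)" "(x, 0)"]
    by (simp add: semidirect_product_def l_simps \<alpha>_simps \<beta>_simps)
  note simps = semidirect_product_def dot_simps l_simps r_simps \<alpha>_simps \<beta>_simps l_beta r_beta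
    zero_prod_def
  show ?thesis
  proof (intro hom_pre_malcev_representation.intro hom_pre_malcev_representation_axioms.intro A V)
    show "Vector_Spaces.linear scaleV scaleV \<beta>" "bilinear_map scaleA scaleV scaleV l"
      "bilinear_map scaleA scaleV scaleV r" by (fact \<beta> l r)+
    show "l (\<alpha> x) (\<beta> a) = \<beta> (l x a)" "r (\<alpha> x) (\<beta> a) = \<beta> (r x a)" for x a
      by (simp_all add: l_beta r_beta)
  next
    fix x y z a
    show "l (A.bracket (A.bracket x y) (\<alpha> z)) (\<beta> (\<beta> a)) =
        l (\<alpha> (\<alpha> x)) (l (\<alpha> y) (l z a)) - l (\<alpha> (\<alpha> z)) (l (\<alpha> x) (l y a))
        + l (\<alpha> (\<alpha> y)) (l (A.bracket z x) (\<beta> a)) - l (\<alpha> (A.bracket y z)) (l (\<alpha> x) (\<beta> a))"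
      using S.pre_malcev[of "(y, 0)" "(z, 0)" "(x, 0)" "(0, a)"]
      by (simp add: simps algebra_simps)
  next
    fix x y z a
    show "r (\<alpha> (\<alpha> x)) (l (\<alpha> y) (l z a - r z a) - r (\<alpha> y) (l z a - r z a))
        - r (dot (\<alpha> z) (dot y x)) (\<beta> (\<beta> a))
        + l (\<alpha> (\<alpha> y)) (r (dot z x) (\<beta> a)) + l (\<alpha> (A.bracket z y)) (r (\<alpha> x) (\<beta> a))
        - l (\<alpha> (\<alpha> z)) (r (\<alpha> x) (l y a - r y a)) = 0"
      using S.pre_malcev[of "(z, 0)" "(y, 0)" "(0, a)" "(x, 0)"]
      by (simp add: simps algebra_simps)
  next
    fix y z x a
    show "l (\<alpha> (\<alpha> y)) (l (\<alpha> z) (r x a))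
        - r (\<alpha> (\<alpha> x)) (l (\<alpha> y) (l z a - r z a) - r (\<alpha> y) (l z a - r z a))
        - l (\<alpha> (\<alpha> z)) (r (dot y x) (\<beta> a))
        - r (\<alpha> (dot z x)) (l (\<alpha> y) (\<beta> a) - r (\<alpha> y) (\<beta> a))
        + r (dot (A.bracket z y) (\<alpha> x)) (\<beta> (\<beta> a)) = 0"
      using S.pre_malcev[of "(0, a)" "(y, 0)" "(z, 0)" "(x, 0)"]
      by (simp add: simps algebra_simps)
  next
    fix y z x a
    show "r (dot (\<alpha> y) (dot z x)) (\<beta> (\<beta> a))
        + r (\<alpha> (\<alpha> x)) (l (A.bracket y z) (\<beta> a) - r (A.bracket y z) (\<beta> a))
        - l (\<alpha> (\<alpha> y)) (l (\<alpha> z) (r x a))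
        + r (\<alpha> (dot y x)) (l (\<alpha> z) (\<beta> a) - r (\<alpha> z) (\<beta> a))
        + l (\<alpha> (\<alpha> z)) (r (\<alpha> x) (l y a - r y a)) = 0"
      using S.pre_malcev[of "(z, 0)" "(0, a)" "(y, 0)" "(x, 0)"]
      by (simp add: simps algebra_simps)
  qed
qed

context hom_pre_alternative_representation
begin

theorem hom_pre_malcev_representation:
  "hom_pre_malcev_representation scaleA (\<lambda>x y. succ x y - prec y x) \<alpha> scaleV
     (\<lambda>x a. Lsucc x a - Rprec x a) (\<lambda>x a. Rsucc x a - Lprec x a) \<beta>"
proof (rule hom_pre_malcev_representation_if_semidirect)
  show "hom_pre_malcev_algebra scaleA (\<lambda>x y. succ x y - prec y x) \<alpha>"
    using A.multiplicative_hom_pre_malcev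
    by (rule multiplicative_hom_pre_malcev_algebra.axioms)
  have "semidirect_product (\<lambda>x y. succ x y - prec y x)
      (\<lambda>x a. Lsucc x a - Rprec x a) (\<lambda>x a. Rsucc x a - Lprec x a)
    = (\<lambda>X Y. semidirect_product succ Lsucc Rsucc X Y - semidirect_product prec Lprec Rprec Y X)"
    by (auto simp: semidirect_product_def fun_eq_iff)
  then show "multiplicative_hom_pre_malcev_algebra (module_prod.scale scaleA scaleV)
    (semidirect_product (\<lambda>x y. succ x y - prec y x)
      (\<lambda>x a. Lsucc x a - Rprec x a) (\<lambda>x a. Rsucc x a - Lprec x a)) (map_prod \<alpha> \<beta>)"
    using hom_pre_alternative_algebra.multiplicative_hom_pre_malcev[OF semidirect] by simp
qed (intro V.vector_space_axioms linear_beta bilinear_map_diff bilinear_Lprec bilinear_Rprec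
    bilinear_Lsucc bilinear_Rsucc)+

end

theorem (in hom_pre_alternative_O_operator) hom_pre_malcev_O_operator:
  "hom_pre_malcev_O_operator scaleA (\<lambda>x y. succ x y - prec y x) \<alpha> scaleV
     (\<lambda>x a. Lsucc x a - Rprec x a) (\<lambda>x a. Rsucc x a - Lprec x a) \<beta> T"
proof -
  interpret M: hom_pre_malcev_representation scaleA "\<lambda>x y. succ x y - prec y x" \<alpha> scaleV
    "\<lambda>x a. Lsucc x a - Rprec x a" "\<lambda>x a. Rsucc x a - Lprec x a" \<beta>
    by (fact hom_pre_malcev_representation)
  show ?thesis
  proof (intro hom_pre_malcev_O_operator.intro hom_pre_malcev_O_operator_axioms.intro
      M.hom_pre_malcev_representation_axioms)
    show "succ (T a) (T b) - prec (T b) (T a)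
      = T (Lsucc (T a) b - Rprec (T a) b + (Rsucc (T b) a - Lprec (T b) a))" for a b
      by (simp add: T_succ T_prec linear_map_simps[OF linear_T])
  qed (fact linear_T T_beta)+
qed

theorem theorem5p1:
  fixes scaleA :: "'k::field_char_0 \<Rightarrow> 'a::ab_group_add \<Rightarrow> 'a"
    and scaleV :: "'k \<Rightarrow> 'v::ab_group_add \<Rightarrow> 'v"
    and mul prec succ dot :: "'a \<Rightarrow> 'a \<Rightarrow> 'a"
    and \<alpha> R :: "'a \<Rightarrow> 'a"
    and Lprec Rprec Lsucc Rsucc l r :: "'a \<Rightarrow> 'v \<Rightarrow> 'v"
    and \<beta> :: "'v \<Rightarrow> 'v" and T :: "'v \<Rightarrow> 'a"
  assumes "hom_alternative_algebra scaleA mul \<alpha>"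
    and "rota_baxter_operator scaleA mul \<alpha> R"
    and "\<And>x y. prec x y = mul x (R y)"
    and "\<And>x y. succ x y = mul (R x) y"
    and "\<And>x y. dot x y = succ x y - prec y x"
    and "hom_pre_alternative_representation scaleA prec succ \<alpha> scaleV Lprec Rprec Lsucc Rsucc \<beta>"
    and "hom_pre_alternative_O_operator scaleA prec succ \<alpha> scaleV Lprec Rprec Lsucc Rsucc \<beta> T"
    and "\<And>x a. l x a = Lsucc x a - Rprec x a"
    and "\<And>x a. r x a = Rsucc x a - Lprec x a"
  shows "multiplicative_hom_pre_malcev_algebra scaleA dot \<alpha>
    \<and> hom_pre_malcev_representation scaleA dot \<alpha> scaleV l r \<beta>
    \<and> hom_pre_malcev_O_operator scaleA dot \<alpha> scaleV l r \<beta> T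
    \<and> (\<forall>a b. dendriform_right r T a b = ne_product Rsucc T a b - sw_product Lprec T b a)
    \<and> (\<forall>a b. dendriform_left l T a b = se_product Lsucc T a b - nw_product Rprec T b a)"
proof -
  interpret hom_pre_alternative_O_operator scaleA prec succ \<alpha> scaleV
    Lprec Rprec Lsucc Rsucc \<beta> T
    by (fact assms(7))
  have dot: "dot = (\<lambda>x y. succ x y - prec y x)"
    and l: "l = (\<lambda>x a. Lsucc x a - Rprec x a)" and r: "r = (\<lambda>x a. Rsucc x a - Lprec x a)"
    using assms(5,8,9) by (simp_all add: fun_eq_iff)
  show ?thesis
    unfolding dot l r
    by (simp add: A.multiplicative_hom_pre_malcev hom_pre_malcev_representation
        hom_pre_malcev_O_operator dendriform_right_def dendriform_left_def
        ne_product_def sw_product_def se_product_def nw_product_def)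
qed

end
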